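(* Let $\mathscr{A} = (a_{ijkl}) \in \mathbb{E}$. If $\mathbb{T}_{\mathscr{A}} \cap \mathbb{S} \neq \emptyset$, then the sequences $\{\mathscr{A}^{(t)}\}$ and $\{\mathscr{B}^{(t)}\}$ produced by the alternating projection algorithm (described in the context) started from $\mathscr{A}^{(0)} = \mathscr{A}$ both converge to one and the same point $\mathscr{A}^\ast \in \mathbb{T}_{\mathscr{A}} \cap \mathbb{S}$.
   Context: $\mathbb{E}$ denotes the set of all real fourth-order three-dimensional tensors $\mathscr{A} = (a_{ijkl}) \in \mathbb{R}^{3\times 3\times 3\times 3}$ such that $a_{ijkl} = a_{jikl} = a_{ijlk}$ for all $i,j,k,l \in \{1,2,3\}$. For a tensor $\mathscr{T} = (t_{ijkl}) \in \mathbb{R}^{3\times 3\times 3\times 3}$ and $\mathbf{Z} = (z_{ij}) \in \mathbb{R}^{3\times 3}$, set $\mathscr{T}\mathbf{Z}^2 := \sum_{i,j,k,l=1}^3 t_{ijkl}z_{ik}z_{jl}$; $\mathscr{T}$ is S-positive semidefinite (S-PSD) if $\mathscr{T}\mathbf{Z}^2 \geq 0$ for all $\mathbf{Z} \in \mathbb{R}^{3\times 3}$. Define $\mathbb{T}_{\mathscr{A}} := \{\mathscr{T} : t_{ijkl} = t_{jilk},\ t_{ijkl} + t_{jikl} = 2a_{ijkl} \text{ for all } i,j,k,l\}$ and $\mathbb{S} := \{\mathscr{T} : t_{ijkl} = t_{jilk} \text{ for all } i,j,k,l,\ \mathscr{T} \text{ is S-PSD}\}$. The unfolding matrix of a tensor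 $\mathscr{T}$ is the $9\times 9$ block matrix $\mathbf{T} = [\mathbf{T}_{kl}]_{k,l=1}^3$ whose $(k,l)$ block is the $3\times 3$ matrix $\mathbf{T}_{kl} = (t_{ijkl})_{i,j=1}^3$ (so the row index of $t_{ijkl}$ is $(k,i)$ and its column index is $(l,j)$); it is symmetric whenever $t_{ijkl} = t_{jilk}$ for all $i,j,k,l$. Algorithm: set $\mathscr{A}^{(0)} = \mathscr{A}$. For $t = 0,1,2,\dots$, let $\mathbf{A}^{(t)}$ be the unfolding matrix of $\mathscr{A}^{(t)}$, with (orthogonal) eigendecomposition $\mathbf{A}^{(t)} = \mathbf{V}^{(t)}\mathbf{D}^{(t)}(\mathbf{V}^{(t)})^\top$, where $\mathbf{D}^{(t)}$ is diagonal with diagonal entries $d^{(t)}_{ii}$. Let $\mathbf{D}_+^{(t)} = \mathrm{diag}(\max(d_{ii}^{(t)},0))$, and let $\mathscr{B}^{(t+1)} = (b^{(t+1)}_{ijkl})$ be the tensor whose unfolding matrix is $\mathbf{B}^{(t+1)} = \mathbf{V}^{(t)}\mathbf{D}_+^{(t)}(\mathbf{V}^{(t)})^\top$. Then define $\mathscr{A}^{(t+1)} = (a^{(t+1)}_{ijkl})$ by $a_{iikl}^{(t+1)} = a_{iikl}$ for $i,k,l = 1,2,3$; $a_{ijkk}^{(t+1)} = a_{ijkk}$ for $i,j,k = 1,2,3$; and $a_{ijkl}^{(t+1)} = a_{ijkl} + \frac{1}{2}\big(b_{ijkl}^{(t+1)} - b_{jikl}^{(t+1)}\big)$ for $i \neq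 j$, $k \neq l$. (Equivalently, $\mathscr{B}^{(t+1)}$ is the projection of $\mathscr{A}^{(t)}$ onto $\mathbb{S}$ and $\mathscr{A}^{(t+1)}$ is the projection of $\mathscr{B}^{(t+1)}$ onto $\mathbb{T}_{\mathscr{A}}$, with respect to the Euclidean (Frobenius) norm.) *)

theory Defs
  imports "HOL-Analysis.Analysis"
begin

text \<open>The entry $t_{ijkl}$ of a tensor \<open>T\<close> is \<open>T $ i $ j $ k $ l\<close>. The norm (hence the
  topology) of this nested vector type is the Frobenius norm.\<close>

type_synonym tensor = "real ^ 3 ^ 3 ^ 3 ^ 3"

definition tensor_E :: "tensor set" where
  "tensor_E = {A. \<forall>i j k l. A $ i $ j $ k $ l = A $ j $ i $ k $ l \<and> A $ i $ j $ k $ l = A $ i $ j $ l $ k}"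

definition tensor_quad :: "tensor \<Rightarrow> real ^ 3 ^ 3 \<Rightarrow> real" where
  "tensor_quad T Z =
     (\<Sum>i\<in>UNIV. \<Sum>j\<in>UNIV. \<Sum>k\<in>UNIV. \<Sum>l\<in>UNIV. T $ i $ j $ k $ l * Z $ i $ k * Z $ j $ l)"

definition S_PSD :: "tensor \<Rightarrow> bool" where
  "S_PSD T \<longleftrightarrow> (\<forall>Z. 0 \<le> tensor_quad T Z)"

definition tensor_T :: "tensor \<Rightarrow> tensor set" where
  "tensor_T A = {T. \<forall>i j k l. T $ i $ j $ k $ l = T $ j $ i $ l $ k \<and>
                      T $ i $ j $ k $ l + T $ j $ i $ k $ l = 2 * A $ i $ j $ k $ l}"

definition tensor_S :: "tensor set" where
  "tensor_S = {T. (\<forall>i j k l. T $ i $ j $ k $ l = T $ j $ i $ l $ k) \<and> S_PSD T}"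

text \<open>The $9 \times 9$ block matrix is indexed by pairs (block index, index within the block):
  $t_{ijkl}$ sits in row $(k,i)$ and column $(l,j)$.\<close>

definition unfolding_matrix :: "tensor \<Rightarrow> real ^ (3 \<times> 3) ^ (3 \<times> 3)" where
  "unfolding_matrix T = (\<chi> r c. T $ snd r $ snd c $ fst r $ fst c)"

definition is_diagonal :: "real ^ 'n ^ 'n \<Rightarrow> bool" where
  "is_diagonal D \<longleftrightarrow> (\<forall>r c. r \<noteq> c \<longrightarrow> D $ r $ c = 0)"

definition eigendecomposition :: "real ^ 'n ^ 'n \<Rightarrow> real ^ 'n ^ 'n \<Rightarrow> real ^ 'n ^ 'n \<Rightarrow> bool" where
  "eigendecomposition M V D \<longleftrightarrow>
     orthogonal_matrix V \<and> is_diagonal D \<and> M = V ** D ** transpose V"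

definition diag_pos_part :: "real ^ 'n ^ 'n \<Rightarrow> real ^ 'n ^ 'n" where
  "diag_pos_part D = (\<chi> r c. if r = c then max (D $ r $ r) 0 else 0)"

text \<open>Here \<open>A\<close> is the initial tensor of the algorithm, not the
  previous iterate.\<close>

definition A_update :: "tensor \<Rightarrow> tensor \<Rightarrow> tensor" where
  "A_update A B = (\<chi> i j k l. if i = j \<or> k = l then A $ i $ j $ k $ l
     else A $ i $ j $ k $ l + 1 / 2 * (B $ i $ j $ k $ l - B $ j $ i $ k $ l))"

text \<open>\<open>As\<close> and \<open>Bs\<close> are sequences produced by the algorithm started from \<open>A\<close>. Eigendecompositions
  are not unique, so this is a relation that admits an arbitrary choice in each step. The algorithm
  produces no \<open>Bs 0\<close>; its value is unconstrained.\<close>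

definition alternating_projection :: "tensor \<Rightarrow> (nat \<Rightarrow> tensor) \<Rightarrow> (nat \<Rightarrow> tensor) \<Rightarrow> bool" where
  "alternating_projection A As Bs \<longleftrightarrow> As 0 = A \<and>
     (\<forall>t. (\<exists>V D. eigendecomposition (unfolding_matrix (As t)) V D \<and>
             unfolding_matrix (Bs (Suc t)) = V ** diag_pos_part D ** transpose V) \<and>
          As (Suc t) = A_update A (Bs (Suc t)))"

end

theory Submission
  imports Defs
begin

text \<open>With respect to the Frobenius inner product each step of the algorithm is a metric projection:
  \<open>Bs (Suc t)\<close> satisfies the variational inequality of the projection of \<open>As t\<close> onto the cone \<open>tensor_S\<close>,
  because the negative spectral part is orthogonal to the positive one and pairs nonpositively with
  every PSD matrix, and \<open>As (Suc t)\<close> satisfies that of the projection of \<open>Bs (Suc t)\<close> onto \<open>tensor_T A\<close>.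
  Hence the distance to every common point is nonincreasing and consecutive iterates approach each
  other. A cluster point exists by compactness and lies in both sets; monotonicity of the distance
  to this point forces convergence of the whole sequence.\<close>

section \<open>Alternating projections\<close>

text \<open>Expanding the square of \<open>(x - p) - (y - p)\<close> leaves the cross term
  \<open>- 2 * ((x - p) \<bullet> (y - p))\<close>, which is nonnegative.\<close>

lemma projection_pythagoras:
  fixes x p y :: "'a::real_inner"
  assumes "(x - p) \<bullet> (y - p) \<le> 0"
  shows "(norm (p - y))\<^sup>2 + (norm (x - p))\<^sup>2 \<le> (norm (x - y))\<^sup>2"
  using assms unfolding power2_norm_eq_inner
  by (simp add: inner_diff_left inner_diff_right inner_commute)

text \<open>The Pythagorean inequality is applied to both half-steps. Only the gap of the first is
  kept: it alone is needed to show that \<open>a\<close> and the shifted \<open>b\<close> have the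
  same cluster points.\<close>

lemma alternating_projections_fejer:
  fixes a b :: "nat \<Rightarrow> 'a::real_inner"
  assumes projS: "(a n - b (Suc n)) \<bullet> (c - b (Suc n)) \<le> 0"
    and projT: "(b (Suc n) - a (Suc n)) \<bullet> (c - a (Suc n)) \<le> 0"
  shows "(norm (a (Suc n) - c))\<^sup>2 + (norm (a n - b (Suc n)))\<^sup>2 \<le> (norm (a n - c))\<^sup>2"
proof -
  have "(norm (a (Suc n) - c))\<^sup>2 \<le> (norm (b (Suc n) - c))\<^sup>2"
    using projection_pythagoras[OF projT] by (smt (verit) zero_le_power2)
  then show ?thesis using projection_pythagoras[OF projS] by linarith
qed

lemma alternating_projections_converge:
  fixes a b :: "nat \<Rightarrow> 'a::euclidean_space"
  assumes "closed S" "closed T" "S \<inter> T \<noteq> {}"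
    and aT: "\<And>n. a n \<in> T" and bS: "\<And>n. b (Suc n) \<in> S"
    and projS: "\<And>n y. y \<in> S \<Longrightarrow> (a n - b (Suc n)) \<bullet> (y - b (Suc n)) \<le> 0"
    and projT: "\<And>n y. y \<in> T \<Longrightarrow> (b (Suc n) - a (Suc n)) \<bullet> (y - a (Suc n)) \<le> 0"
  shows "\<exists>x \<in> T \<inter> S. a \<longlonglongrightarrow> x \<and> b \<longlonglongrightarrow> x"
proof -
  have fejer: "(norm (a (Suc n) - c))\<^sup>2 + (norm (a n - b (Suc n)))\<^sup>2 \<le> (norm (a n - c))\<^sup>2"
    if "c \<in> S \<inter> T" for c n
    using that by (intro alternating_projections_fejer projS projT) auto
  have dec: "decseq (\<lambda>n. (norm (a n - c))\<^sup>2)" if "c \<in> S \<inter> T" for c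
    unfolding decseq_Suc_iff using fejer[OF that] by (smt (verit) zero_le_power2)
  have conv: "convergent (\<lambda>n. (norm (a n - c))\<^sup>2)" if "c \<in> S \<inter> T" for c
    using decseq_convergent[OF dec[OF that], of 0] by (auto simp: convergent_def)
  obtain c where c: "c \<in> S \<inter> T" using assms(3) by auto
  obtain L where L: "(\<lambda>n. (norm (a n - c))\<^sup>2) \<longlonglongrightarrow> L" using conv[OF c] by (auto simp: convergent_def)
  have "(\<lambda>n. (norm (a n - c))\<^sup>2 - (norm (a (Suc n) - c))\<^sup>2) \<longlonglongrightarrow> L - L"
    using L LIMSEQ_Suc[OF L] by (rule tendsto_diff)
  then have lim: "(\<lambda>n. (norm (a n - c))\<^sup>2 - (norm (a (Suc n) - c))\<^sup>2) \<longlonglongrightarrow> 0" by simp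
  \<comment> \<open>The gap is squeezed between 0 and consecutive differences of a convergent
    sequence.\<close>
  have "(norm (a n - b (Suc n)))\<^sup>2 \<le> (norm (a n - c))\<^sup>2 - (norm (a (Suc n) - c))\<^sup>2" for n
    using fejer[OF c, of n] by linarith
  then have "(\<lambda>n. (norm (a n - b (Suc n)))\<^sup>2) \<longlonglongrightarrow> 0"
    by (intro tendsto_sandwich[OF _ _ tendsto_const lim] always_eventually allI zero_le_power2)
  then have gap: "(\<lambda>n. a n - b (Suc n)) \<longlonglongrightarrow> 0"
    using tendsto_real_sqrt by (fastforce simp: tendsto_norm_zero_iff)
  have "norm (a n - c) \<le> norm (a 0 - c)" for n
    using decseqD[OF dec[OF c], of 0 n] by (simp add: power2_le_iff_abs_le)
  then have "a n \<in> cball c (norm (a 0 - c))" for n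
    by (simp add: dist_norm norm_minus_commute)
  then obtain x r where r: "strict_mono r" and x: "(a \<circ> r) \<longlonglongrightarrow> x"
    using compact_cball[of c "norm (a 0 - c)"] unfolding compact_def by metis
  have "(\<lambda>n. a (r n) - b (Suc (r n))) \<longlonglongrightarrow> 0"
    using LIMSEQ_subseq_LIMSEQ[OF gap r] by (simp add: o_def)
  from tendsto_diff[OF x[unfolded o_def] this] have "(\<lambda>n. b (Suc (r n))) \<longlonglongrightarrow> x" by simp
  then have "x \<in> S" by (rule closed_sequentially[OF \<open>closed S\<close> bS])
  moreover have "x \<in> T" using closed_sequentially[OF \<open>closed T\<close> _ x] aT by simp
  ultimately have xST: "x \<in> S \<inter> T" by simp
  \<comment> \<open>The cluster point now serves as the reference point \<open>c\<close>. The
    squared distances to it converge, and along \<open>r\<close> they tend to 0, so their limit is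
    0.\<close>
  obtain l where l: "(\<lambda>n. (norm (a n - x))\<^sup>2) \<longlonglongrightarrow> l" using conv[OF xST] by (auto simp: convergent_def)
  have "(\<lambda>n. (norm ((a \<circ> r) n - x))\<^sup>2) \<longlonglongrightarrow> (norm (x - x))\<^sup>2"
    by (intro tendsto_intros x)
  then have "l = 0" using LIMSEQ_unique[OF LIMSEQ_subseq_LIMSEQ[OF l r]] by (simp add: o_def)
  then have "(\<lambda>n. a n - x) \<longlonglongrightarrow> 0"
    using l tendsto_real_sqrt by (fastforce simp: tendsto_norm_zero_iff)
  then have ax: "a \<longlonglongrightarrow> x" using LIM_zero_cancel by blast
  \<comment> \<open>This difference is \<open>b (Suc n)\<close>; prepending the arbitrary
    \<open>b 0\<close> leaves the limit unchanged.\<close>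
  from tendsto_diff[OF this gap] have "b \<longlonglongrightarrow> x" by (simp add: filterlim_sequentially_Suc)
  with ax xST show ?thesis by blast
qed

section \<open>Spectral truncation\<close>

text \<open>Entrywise form of the spectral sum of rank-one matrices built from the columns of
  \<open>V\<close>.\<close>

lemma conj_diag_nth:
  fixes V :: "real ^ 'n ^ 'm" and N :: "real ^ 'n ^ 'n"
  assumes "is_diagonal N"
  shows "(V ** N ** transpose V) $ r $ c = (\<Sum>m\<in>UNIV. N $ m $ m * (V $ r $ m * V $ c $ m))"
proof -
  have "(\<Sum>k\<in>UNIV. V $ r $ k * N $ k $ m) = V $ r $ m * N $ m $ m" for m
  proof -
    have "(\<Sum>k\<in>UNIV. V $ r $ k * N $ k $ m) = (\<Sum>k\<in>{m}. V $ r $ k * N $ k $ m)"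
      using assms by (intro sum.mono_neutral_right) (auto simp: is_diagonal_def)
    then show ?thesis by simp
  qed
  then show ?thesis
    by (simp add: matrix_matrix_mult_def transpose_def mult_ac)
qed

text \<open>The Frobenius product of \<open>M\<close> with the rank-one matrix of a vector
  \<open>v\<close> is \<open>v \<bullet> (M *v v)\<close>. The pairing thus sees only the diagonal
  of \<open>M\<close> in the basis of columns.\<close>

lemma inner_conj_diag:
  fixes M :: "real ^ 'm ^ 'm" and V :: "real ^ 'n ^ 'm" and N :: "real ^ 'n ^ 'n"
  assumes "is_diagonal N"
  shows "M \<bullet> (V ** N ** transpose V) =
    (\<Sum>m\<in>UNIV. N $ m $ m * (column m V \<bullet> (M *v column m V)))"
proof -
  have "M \<bullet> (V ** N ** transpose V) =
      (\<Sum>r\<in>UNIV. \<Sum>c\<in>UNIV. \<Sum>m\<in>UNIV. M $ r $ c * (N $ m $ m * (V $ r $ m * V $ c $ m)))"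
    by (simp add: inner_vec_def conj_diag_nth[OF assms] sum_distrib_left)
  also have "\<dots> = (\<Sum>r\<in>UNIV. \<Sum>m\<in>UNIV. \<Sum>c\<in>UNIV. M $ r $ c * (N $ m $ m * (V $ r $ m * V $ c $ m)))"
    by (intro sum.cong refl sum.swap)
  also have "\<dots> = (\<Sum>m\<in>UNIV. \<Sum>r\<in>UNIV. \<Sum>c\<in>UNIV. M $ r $ c * (N $ m $ m * (V $ r $ m * V $ c $ m)))"
    by (rule sum.swap)
  finally show ?thesis
    by (simp add: inner_vec_def matrix_vector_mult_def column_def sum_distrib_left mult_ac)
qed

lemma quad_conj_diag:
  fixes V :: "real ^ 'n ^ 'm" and N :: "real ^ 'n ^ 'n"
  assumes "is_diagonal N"
  shows "z \<bullet> ((V ** N ** transpose V) *v z) = (\<Sum>m\<in>UNIV. N $ m $ m * (column m V \<bullet> z)\<^sup>2)"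
proof -
  have "z \<bullet> ((V ** N ** transpose V) *v z) =
      (\<Sum>r\<in>UNIV. \<Sum>c\<in>UNIV. \<Sum>m\<in>UNIV. N $ m $ m * (V $ r $ m * z $ r) * (V $ c $ m * z $ c))"
    by (simp add: inner_vec_def matrix_vector_mult_def conj_diag_nth[OF assms]
        sum_distrib_left sum_distrib_right mult_ac)
  also have "\<dots> = (\<Sum>r\<in>UNIV. \<Sum>m\<in>UNIV. \<Sum>c\<in>UNIV. N $ m $ m * (V $ r $ m * z $ r) * (V $ c $ m * z $ c))"
    by (intro sum.cong refl sum.swap)
  also have "\<dots> = (\<Sum>m\<in>UNIV. \<Sum>r\<in>UNIV. \<Sum>c\<in>UNIV. N $ m $ m * (V $ r $ m * z $ r) * (V $ c $ m * z $ c))"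
    by (rule sum.swap)
  finally show ?thesis
    by (simp add: inner_vec_def column_def power2_eq_square sum_product sum_distrib_left mult_ac)
qed

lemma is_diagonal_diag_pos_part: "is_diagonal (diag_pos_part D)"
  by (simp add: is_diagonal_def diag_pos_part_def)

lemma conj_diag_symmetric:
  fixes V :: "real ^ 'n ^ 'm" and N :: "real ^ 'n ^ 'n"
  assumes "is_diagonal N"
  shows "(V ** N ** transpose V) $ r $ c = (V ** N ** transpose V) $ c $ r"
  by (simp add: conj_diag_nth[OF assms] mult_ac)

lemma quad_pos_part_nonneg:
  fixes V :: "real ^ 'n ^ 'm" and D :: "real ^ 'n ^ 'n"
  shows "0 \<le> z \<bullet> ((V ** diag_pos_part D ** transpose V) *v z)"
  unfolding quad_conj_diag[OF is_diagonal_diag_pos_part]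
  by (intro sum_nonneg) (simp add: diag_pos_part_def)

text \<open>By orthonormality of the columns only the summand with index \<open>m\<close>
  survives.\<close>

lemma quad_orthogonal_conj_diag_column:
  fixes V N :: "real ^ 'n ^ 'n"
  assumes "orthogonal_matrix V" "is_diagonal N"
  shows "column m V \<bullet> ((V ** N ** transpose V) *v column m V) = N $ m $ m"
proof -
  have "N $ k $ k * (column k V \<bullet> column m V)\<^sup>2 = (if k = m then N $ m $ m else 0)" for k
    using assms(1) unfolding orthogonal_matrix_orthonormal_columns
    by (auto simp: orthogonal_def norm_eq_1)
  then show ?thesis
    by (simp only: quad_conj_diag[OF assms(2)]) simp
qed

lemma pos_part_projection:
  fixes M V D C :: "real ^ 'n ^ 'n"
  assumes eig: "eigendecomposition M V D" and psd: "\<And>z. 0 \<le> z \<bullet> (C *v z)"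
  defines "P \<equiv> V ** diag_pos_part D ** transpose V"
  shows "(M - P) \<bullet> (C - P) \<le> 0"
proof -
  \<comment> \<open>\<open>N\<close> is the negative spectral part: its diagonal entries are
    \<open>min (D $ m $ m) 0\<close>.\<close>
  define N where "N = D - diag_pos_part D"
  have V: "orthogonal_matrix V" and D: "is_diagonal D" and M: "M = V ** D ** transpose V"
    using eig by (auto simp: eigendecomposition_def)
  have N: "is_diagonal N"
    using D by (simp add: N_def is_diagonal_def diag_pos_part_def)
  have "M - P = V ** N ** transpose V"
    unfolding vec_eq_iff M P_def vector_minus_component conj_diag_nth[OF D]
      conj_diag_nth[OF N] conj_diag_nth[OF is_diagonal_diag_pos_part]
    by (simp add: N_def sum_subtractf left_diff_distrib)
  then have "(M - P) \<bullet> (C - P) = (C - P) \<bullet> (V ** N ** transpose V)"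
    by (simp add: inner_commute)
  also have "\<dots> = (\<Sum>m\<in>UNIV. N $ m $ m * (column m V \<bullet> (C *v column m V) - diag_pos_part D $ m $ m))"
    by (simp add: inner_conj_diag[OF N] matrix_vector_mult_diff_rdistrib inner_diff_right P_def
        quad_orthogonal_conj_diag_column[OF V is_diagonal_diag_pos_part])
  \<comment> \<open>For each \<open>m\<close>, either \<open>N $ m $ m\<close> is 0, or it is
    negative and the positive part vanishes there, leaving a negative factor times a nonnegative
    value of the form of \<open>C\<close>.\<close>
  also have "\<dots> \<le> 0"
    using psd by (intro sum_nonpos)
      (auto simp: N_def diag_pos_part_def max_def intro: mult_nonpos_nonneg)
  finally show ?thesis .
qed

section \<open>Tensors and their unfoldings\<close>

lemma sum_prod_index:
  "(\<Sum>r\<in>UNIV. f r) = (\<Sum>k\<in>UNIV. \<Sum>i\<in>UNIV. f (k, i))" for f :: "'a::finite \<times> 'b::finite \<Rightarrow> real"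
  by (simp add: sum.cartesian_product)

lemma inner_tensor:
  "T \<bullet> U = (\<Sum>i\<in>UNIV. \<Sum>j\<in>UNIV. \<Sum>k\<in>UNIV. \<Sum>l\<in>UNIV. T $ i $ j $ k $ l * U $ i $ j $ k $ l)"
  for T U :: tensor
  by (simp add: inner_vec_def)

text \<open>Moves the summation order \<open>k, i, l, j\<close> of the unfolding to the order of the tensor indices.\<close>
lemma sum_unfolding_order:
  fixes f :: "'a::finite \<Rightarrow> 'b::finite \<Rightarrow> 'c::finite \<Rightarrow> 'd::finite \<Rightarrow> real"
  shows "(\<Sum>k\<in>UNIV. \<Sum>i\<in>UNIV. \<Sum>l\<in>UNIV. \<Sum>j\<in>UNIV. f i j k l) =
    (\<Sum>i\<in>UNIV. \<Sum>j\<in>UNIV. \<Sum>k\<in>UNIV. \<Sum>l\<in>UNIV. f i j k l)"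
proof -
  have "(\<Sum>k\<in>UNIV. \<Sum>i\<in>UNIV. \<Sum>l\<in>UNIV. \<Sum>j\<in>UNIV. f i j k l) =
      (\<Sum>i\<in>UNIV. \<Sum>k\<in>UNIV. \<Sum>l\<in>UNIV. \<Sum>j\<in>UNIV. f i j k l)"
    by (rule sum.swap)
  also have "\<dots> = (\<Sum>i\<in>UNIV. \<Sum>k\<in>UNIV. \<Sum>j\<in>UNIV. \<Sum>l\<in>UNIV. f i j k l)"
    by (intro sum.cong refl sum.swap)
  also have "\<dots> = (\<Sum>i\<in>UNIV. \<Sum>j\<in>UNIV. \<Sum>k\<in>UNIV. \<Sum>l\<in>UNIV. f i j k l)"
    by (intro sum.cong refl sum.swap)
  finally show ?thesis .
qed

text \<open>Unfolding only rearranges entries, so it is an isometry for the Frobenius norm.\<close>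

lemma inner_unfolding_matrix: "unfolding_matrix T \<bullet> unfolding_matrix U = T \<bullet> U"
  unfolding inner_tensor
  by (subst sum_unfolding_order[symmetric])
     (simp add: inner_vec_def unfolding_matrix_def sum_prod_index)

lemma unfolding_matrix_diff: "unfolding_matrix (T - U) = unfolding_matrix T - unfolding_matrix U"
  by (simp add: unfolding_matrix_def vec_eq_iff)

lemma tensor_quad_unfolding:
  "tensor_quad T Z = (\<chi> r. Z $ snd r $ fst r) \<bullet> (unfolding_matrix T *v (\<chi> r. Z $ snd r $ fst r))"
  unfolding tensor_quad_def
  by (subst sum_unfolding_order[symmetric])
     (simp add: inner_vec_def matrix_vector_mult_def unfolding_matrix_def sum_prod_index
      sum_distrib_left mult_ac)

lemma S_PSD_unfolding: "S_PSD T \<longleftrightarrow> (\<forall>z. 0 \<le> z \<bullet> (unfolding_matrix T *v z))"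
proof
  assume T: "S_PSD T"
  show "\<forall>z. 0 \<le> z \<bullet> (unfolding_matrix T *v z)"
  proof
    fix z :: "real ^ (3 \<times> 3)"
    \<comment> \<open>Every vector of length 9 is the vectorization of a matrix, so no test vector
      is lost.\<close>
    have z: "(\<chi> r. (\<chi> i k. z $ (k, i)) $ snd r $ fst r) = z"
      by (simp add: vec_eq_iff)
    have "0 \<le> tensor_quad T (\<chi> i k. z $ (k, i))"
      using T by (simp add: S_PSD_def)
    then show "0 \<le> z \<bullet> (unfolding_matrix T *v z)"
      unfolding tensor_quad_unfolding z .
  qed
qed (simp add: S_PSD_def tensor_quad_unfolding)

section \<open>The constraint sets and the projections onto them\<close>

lemma closed_tensor_S: "closed tensor_S"
proof -
  have "tensor_S = {T. \<forall>i j k l. T $ i $ j $ k $ l = T $ j $ i $ l $ k} \<inter> {T. \<forall>Z. 0 \<le> tensor_quad T Z}"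
    by (auto simp: tensor_S_def S_PSD_def)
  also have "closed \<dots>"
    unfolding tensor_quad_def
    by (intro closed_Int closed_Collect_all closed_Collect_eq closed_Collect_le continuous_intros)
  finally show ?thesis .
qed

lemma closed_tensor_T: "closed (tensor_T A)"
  unfolding tensor_T_def
  by (intro closed_Collect_all closed_Collect_conj closed_Collect_eq continuous_intros)

text \<open>Places the starting point in the affine set; composing the two symmetries of
  \<open>tensor_E\<close> gives the simultaneous swap.\<close>

lemma tensor_E_subset_tensor_T: "A \<in> tensor_E \<Longrightarrow> A \<in> tensor_T A"
  unfolding tensor_E_def tensor_T_def mem_Collect_eq by (metis mult_2)

text \<open>The matrix projection carries over through the isometry; the index symmetry of
  \<open>tensor_S\<close> is symmetry of the unfolding matrix.\<close>

lemma tensor_S_projection: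
  assumes eig: "eigendecomposition (unfolding_matrix A) V D"
    and B: "unfolding_matrix B = V ** diag_pos_part D ** transpose V"
  shows "B \<in> tensor_S"
    and "C \<in> tensor_S \<Longrightarrow> (A - B) \<bullet> (C - B) \<le> 0"
proof -
  have "B $ i $ j $ k $ l = B $ j $ i $ l $ k" for i j k l
    using conj_diag_symmetric[OF is_diagonal_diag_pos_part, of V D "(k, i)" "(l, j)"]
    unfolding B[symmetric] by (simp add: unfolding_matrix_def)
  then show "B \<in> tensor_S"
    by (simp add: tensor_S_def S_PSD_unfolding B quad_pos_part_nonneg)
  assume "C \<in> tensor_S"
  then have "(unfolding_matrix A - unfolding_matrix B) \<bullet> (unfolding_matrix C - unfolding_matrix B) \<le> 0"
    unfolding B by (intro pos_part_projection[OF eig]) (simp add: tensor_S_def S_PSD_unfolding)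
  then show "(A - B) \<bullet> (C - B) \<le> 0"
    by (simp add: inner_unfolding_matrix flip: unfolding_matrix_diff)
qed

text \<open>On tensors with the symmetry of \<open>tensor_S\<close> the correction term vanishes when \<open>i = j\<close> or
  \<open>k = l\<close>, so the case distinction in \<open>A_update\<close> disappears.\<close>
lemma A_update_nth:
  assumes "\<And>i j k l. B $ i $ j $ k $ l = B $ j $ i $ l $ k"
  shows "A_update A B $ i $ j $ k $ l = A $ i $ j $ k $ l + (B $ i $ j $ k $ l - B $ j $ i $ k $ l) / 2"
  using assms[of i j k k] by (cases "i = j"; cases "k = l") (simp_all add: A_update_def)

text \<open>The correction is antisymmetric in \<open>i\<close>, \<open>j\<close>, so it cancels in
  the sum, and it is invariant under the simultaneous swap of both index pairs.\<close>

lemma A_update_in_tensor_T: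
  assumes A: "A \<in> tensor_E" and B: "\<And>i j k l. B $ i $ j $ k $ l = B $ j $ i $ l $ k"
  shows "A_update A B \<in> tensor_T A"
proof -
  have sym: "A $ i $ j $ k $ l = A $ j $ i $ k $ l" "A $ i $ j $ k $ l = A $ j $ i $ l $ k" for i j k l
    using A unfolding tensor_E_def mem_Collect_eq by metis+
  show ?thesis
    unfolding tensor_T_def mem_Collect_eq A_update_nth[of B, OF B]
  proof (intro allI conjI)
    fix i j k l
    show "A $ i $ j $ k $ l + (B $ i $ j $ k $ l - B $ j $ i $ k $ l) / 2 =
        A $ j $ i $ l $ k + (B $ j $ i $ l $ k - B $ i $ j $ l $ k) / 2"
      using sym(2)[of i j k l] B[of i j k l] B[of j i k l] by simp
    show "A $ i $ j $ k $ l + (B $ i $ j $ k $ l - B $ j $ i $ k $ l) / 2 +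
        (A $ j $ i $ k $ l + (B $ j $ i $ k $ l - B $ i $ j $ k $ l) / 2) = 2 * A $ i $ j $ k $ l"
      using sym(1)[of i j k l] by (simp add: field_simps)
  qed
qed

text \<open>The residual \<open>B - A_update A B\<close> is symmetric in its first two indices, whereas differences of
  elements of \<open>tensor_T A\<close> are antisymmetric in them.\<close>
lemma A_update_orthogonal:
  assumes A: "A \<in> tensor_E" and B: "\<And>i j k l. B $ i $ j $ k $ l = B $ j $ i $ l $ k"
    and C: "C \<in> tensor_T A"
  shows "(B - A_update A B) \<bullet> (C - A_update A B) = 0"
proof -
  define R where "R = B - A_update A B"
  define U where "U = C - A_update A B"
  have R: "R $ i $ j $ k $ l = R $ j $ i $ k $ l" for i j k l
  proof -
    have "A $ i $ j $ k $ l = A $ j $ i $ k $ l" using A by (simp add: tensor_E_def)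
    then show ?thesis by (simp add: R_def A_update_nth[of B, OF B] field_simps)
  qed
  have U: "U $ i $ j $ k $ l = - U $ j $ i $ k $ l" for i j k l
  proof -
    have "X $ i $ j $ k $ l + X $ j $ i $ k $ l = 2 * A $ i $ j $ k $ l" if "X \<in> tensor_T A" for X
      using that unfolding tensor_T_def by blast
    from this[OF C] this[OF A_update_in_tensor_T[of A B, OF A B]] show ?thesis by (simp add: U_def)
  qed
  \<comment> \<open>Exchanging the roles of \<open>i\<close> and \<open>j\<close> shows that the
    inner product equals its own negative.\<close>
  have "R \<bullet> U = (\<Sum>j\<in>UNIV. \<Sum>i\<in>UNIV. \<Sum>k\<in>UNIV. \<Sum>l\<in>UNIV. R $ i $ j $ k $ l * U $ i $ j $ k $ l)"
    unfolding inner_tensor by (rule sum.swap)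
  also have "\<dots> = (\<Sum>j\<in>UNIV. \<Sum>i\<in>UNIV. \<Sum>k\<in>UNIV. \<Sum>l\<in>UNIV. - (R $ j $ i $ k $ l * U $ j $ i $ k $ l))"
    using R U by (intro sum.cong refl) (metis mult_minus_right)
  also have "\<dots> = - (R \<bullet> U)"
    by (simp add: inner_tensor sum_negf)
  finally show ?thesis by (simp add: R_def U_def)
qed

theorem theorem3p3:
  fixes A :: tensor and As Bs :: "nat \<Rightarrow> tensor"
  assumes "A \<in> tensor_E"
    and "tensor_T A \<inter> tensor_S \<noteq> {}"
    and "alternating_projection A As Bs"
  shows "\<exists>Astar \<in> tensor_T A \<inter> tensor_S. As \<longlonglongrightarrow> Astar \<and> Bs \<longlonglongrightarrow> Astar"
proof -
  have As0: "As 0 = A" and AsSuc: "\<And>t. As (Suc t) = A_update A (Bs (Suc t))"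
    and eig: "\<And>t. \<exists>V D. eigendecomposition (unfolding_matrix (As t)) V D \<and>
             unfolding_matrix (Bs (Suc t)) = V ** diag_pos_part D ** transpose V"
    using assms(3) by (auto simp: alternating_projection_def)
  have Bs: "Bs (Suc t) \<in> tensor_S" for t
    using eig[of t] tensor_S_projection(1) by blast
  then have sym: "Bs (Suc t) $ i $ j $ k $ l = Bs (Suc t) $ j $ i $ l $ k" for t i j k l
    by (simp add: tensor_S_def)
  show ?thesis
  proof (rule alternating_projections_converge[OF closed_tensor_S closed_tensor_T, where b = Bs])
    show "Bs (Suc n) \<in> tensor_S" for n by (rule Bs)
    show "tensor_S \<inter> tensor_T A \<noteq> {}" using assms(2) by blast
    show "As n \<in> tensor_T A" for n
      by (cases n) (auto simp: As0 AsSuc intro: tensor_E_subset_tensor_T A_update_in_tensor_T assms(1) sym)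
    show "(As n - Bs (Suc n)) \<bullet> (y - Bs (Suc n)) \<le> 0" if "y \<in> tensor_S" for n y
      using eig[of n] tensor_S_projection(2) that by blast
    \<comment> \<open>Since \<open>tensor_T A\<close> is affine, the variational inequality holds
      with equality, as orthogonality.\<close>
    show "(Bs (Suc n) - As (Suc n)) \<bullet> (y - As (Suc n)) \<le> 0" if "y \<in> tensor_T A" for n y
      unfolding AsSuc using A_update_orthogonal[OF assms(1) sym that] by simp
  qed
qed

end
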